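(* Let $n\ge 1$ and let $a\in L^\infty(\mathrm{D}^{\mathrm{I}}_{n\times n})$ be given. Then the following conditions are equivalent. (1) The symbol $a$ satisfies $a(U^{-1}ZV)=a(Z)$ for every $U,V\in\mathrm{U}(n)$ and $Z\in\mathrm{D}^{\mathrm{I}}_{n\times n}\cap M_{n\times n}(\mathbb{C})^\times$. (2) For every $U,V\in\mathrm{U}(n)$ and $x\in\overrightarrow{(0,1)}^n$ we have $a(UD(x)V)=a(D(x))$. (3) The function $a\circ\varphi$ defined on $\mathrm{U}(n)\times\mathrm{U}(n)\times\overrightarrow{(0,1)}^n$ depends only on the factor $\overrightarrow{(0,1)}^n$. (4) The function $a\circ\widehat{\varphi}$ defined on $(\mathrm{U}(n)\times\mathrm{U}(n))/\mathbb{T}^n\times\overrightarrow{(0,1)}^n$ depends only on the factor $\overrightarrow{(0,1)}^n$.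
   Context: $\mathrm{D}^{\mathrm{I}}_{n\times n}=\{Z\in M_{n\times n}(\mathbb{C}): Z^*Z<I_n\}$. Here $a$ is a measurable, essentially bounded function defined at every point of $\mathrm{D}^{\mathrm{I}}_{n\times n}$ (a symbol), and the identities are pointwise. For $z\in\mathbb{C}^n$, $D(z)$ is the diagonal matrix with diagonal entries the components of $z$. $M_{n\times n}(\mathbb{C})^\times$ is the set of complex $n\times n$ matrices $Z$ such that $ZZ^*$ is positive definite with all of its eigenvalues of multiplicity one. $\overrightarrow{(0,1)}^n=\{x\in\mathbb{R}^n: 1>x_1>\dots>x_n>0\}$. $(\mathrm{U}(n)\times\mathrm{U}(n))/\mathbb{T}^n$ is the quotient by the $\mathbb{T}^n$-action $t\cdot(U,V)=(U D(\overline{t}),D(t)V)$ ($\mathbb{T}$ the unit circle), with classes $[U,V]$. The maps are $\varphi(U,V,x)=UD(x)V$ and $\widehat{\varphi}([U,V],x)=UD(x)V$. *)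

theory Defs
  imports "HOL-Analysis.Analysis" "HOL-Computational_Algebra.Polynomial"
begin

text \<open>
  The \<open>n \<times> n\<close> complex matrices are the elements of \<^typ>\<open>complex^'n^'n\<close>, where \<open>n = CARD('n)\<close>.
  Wherever the order of the coordinates \<open>1, \<dots>, n\<close> matters, the index type is in addition
  linearly ordered; every such finite type is order isomorphic to \<open>{1..n}\<close>.
\<close>

definition conj_transpose :: "complex^'n^'m \<Rightarrow> complex^'m^'n" where
  "conj_transpose A = (\<chi> i j. cnj (A $ j $ i))"

definition unitary_group :: "(complex^'n^'n) set" where
  "unitary_group = {U. conj_transpose U ** U = mat 1 \<and> U ** conj_transpose U = mat 1}"

definition quadratic_form :: "complex^'n^'n \<Rightarrow> complex^'n \<Rightarrow> complex" where
  "quadratic_form A v = (\<Sum>i\<in>UNIV. cnj (v $ i) * (A *v v) $ i)"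

definition pos_definite :: "complex^'n^'n \<Rightarrow> bool" where
  "pos_definite A \<longleftrightarrow> conj_transpose A = A \<and>
     (\<forall>v. v \<noteq> 0 \<longrightarrow> quadratic_form A v \<in> \<real> \<and> 0 < Re (quadratic_form A v))"

definition matrix_less :: "complex^'n^'n \<Rightarrow> complex^'n^'n \<Rightarrow> bool" where
  "matrix_less A B \<longleftrightarrow> pos_definite (B - A)"

definition cartan_domain_I :: "(complex^'n^'n) set" where
  "cartan_domain_I = {Z. matrix_less (conj_transpose Z ** Z) (mat 1)}"

definition char_polynomial :: "complex^'n^'n \<Rightarrow> complex poly" where
  "char_polynomial A = det (\<chi> i j. (if i = j then [:0, 1:] else 0) - [:A $ i $ j:])"

definition is_eigenvalue :: "complex^'n^'n \<Rightarrow> complex \<Rightarrow> bool" where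
  "is_eigenvalue A c \<longleftrightarrow> (\<exists>v. v \<noteq> 0 \<and> A *v v = c *s v)"

definition eigenvalue_multiplicity :: "complex^'n^'n \<Rightarrow> complex \<Rightarrow> nat" where
  "eigenvalue_multiplicity A c = order c (char_polynomial A)"

text \<open>The set \<open>M\<^sub>n\<^sub>\<times>\<^sub>n(\<complex>)\<^sup>\<times>\<close>; it is a proper subset of the invertible matrices for \<open>n \<ge> 2\<close>.\<close>

definition regular_matrices :: "(complex^'n^'n) set" where
  "regular_matrices = {Z. pos_definite (Z ** conj_transpose Z) \<and>
     (\<forall>c. is_eigenvalue (Z ** conj_transpose Z) c \<longrightarrow>
          eigenvalue_multiplicity (Z ** conj_transpose Z) c = 1)}"

definition diag_mat :: "complex^'n \<Rightarrow> complex^'n^'n" where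
  "diag_mat z = (\<chi> i j. if i = j then z $ i else 0)"

definition complex_vec :: "real^'n \<Rightarrow> complex^'n" where
  "complex_vec x = (\<chi> i. complex_of_real (x $ i))"

definition decreasing_cube :: "(real^'n::{finite,linorder}) set" where
  "decreasing_cube = {x. (\<forall>i. 0 < x $ i \<and> x $ i < 1) \<and> (\<forall>i j. i < j \<longrightarrow> x $ j < x $ i)}"

text \<open>
  Functions that are measurable and essentially bounded; they are not identified
  when they agree almost everywhere.
\<close>

definition Linfty :: "'a measure \<Rightarrow> ('a \<Rightarrow> complex) set" where
  "Linfty M = {f \<in> borel_measurable M. \<exists>C. AE x in M. norm (f x) \<le> C}"

definition torus :: "(complex^'n) set" where
  "torus = {t. \<forall>i. norm (t $ i) = 1}"

definition torus_action ::
    "complex^'n \<Rightarrow> (complex^'n^'n) \<times> (complex^'n^'n) \<Rightarrow> (complex^'n^'n) \<times> (complex^'n^'n)" where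
  "torus_action t = (\<lambda>(U, V). (U ** diag_mat (\<chi> i. cnj (t $ i)), diag_mat t ** V))"

definition torus_orbit_rel ::
    "(((complex^'n^'n) \<times> (complex^'n^'n)) \<times> ((complex^'n^'n) \<times> (complex^'n^'n))) set" where
  "torus_orbit_rel =
     {(p, q). p \<in> unitary_group \<times> unitary_group \<and> (\<exists>t\<in>torus. q = torus_action t p)}"

definition torus_quotient :: "((complex^'n^'n) \<times> (complex^'n^'n)) set set" where
  "torus_quotient = (unitary_group \<times> unitary_group) // torus_orbit_rel"

definition \<phi> ::
    "(complex^'n^'n) \<times> (complex^'n^'n) \<times> (real^'n) \<Rightarrow> complex^'n^'n" where
  "\<phi> = (\<lambda>(U, V, x). U ** diag_mat (complex_vec x) ** V)"

text \<open>
  The map induced by \<open>\<phi>\<close> on classes: the common value of \<open>\<phi>\<close> on the representatives.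
\<close>

definition \<phi>_hat ::
    "((complex^'n^'n) \<times> (complex^'n^'n)) set \<times> (real^'n) \<Rightarrow> complex^'n^'n" where
  "\<phi>_hat = (\<lambda>(c, x). the_elem ((\<lambda>(U, V). \<phi> (U, V, x)) ` c))"

definition depends_only_on :: "('a \<Rightarrow> 'b) \<Rightarrow> 'a set \<Rightarrow> ('a \<Rightarrow> 'c) \<Rightarrow> bool" where
  "depends_only_on p A f \<longleftrightarrow> (\<exists>g. \<forall>y\<in>A. f y = g (p y))"

lemma diag_mat_mult: "diag_mat z ** diag_mat w = diag_mat (\<chi> i. z $ i * w $ i)"
  by (simp add: diag_mat_def matrix_matrix_mult_def vec_eq_iff if_distrib[where f = "\<lambda>y. y * _"]
        if_distrib[where f = "\<lambda>y. _ * y"] cong: if_cong)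

lemma diag_mat_1: "diag_mat (\<chi> i. 1) = mat 1"
  by (simp add: diag_mat_def mat_def vec_eq_iff)

lemma conj_transpose_mult: "conj_transpose (A ** B) = conj_transpose B ** conj_transpose A"
  by (simp add: conj_transpose_def matrix_matrix_mult_def vec_eq_iff mult.commute)

lemma conj_transpose_diag: "conj_transpose (diag_mat z) = diag_mat (\<chi> i. cnj (z $ i))"
  by (auto simp: conj_transpose_def diag_mat_def vec_eq_iff)

lemma torus_cnj: "t \<in> torus \<Longrightarrow> t $ i * cnj (t $ i) = 1" "t \<in> torus \<Longrightarrow> cnj (t $ i) * t $ i = 1"
  by (simp_all add: torus_def complex_norm_square[symmetric] mult.commute)

lemma torus_diag:
  assumes "t \<in> torus"
  shows "diag_mat t ** diag_mat (\<chi> i. cnj (t $ i)) = mat 1"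
    and "diag_mat (\<chi> i. cnj (t $ i)) ** diag_mat t = mat 1"
  using assms by (simp_all add: diag_mat_mult torus_cnj diag_mat_1)

lemma unitary_mult:
  assumes "U \<in> unitary_group" "V \<in> unitary_group"
  shows "U ** V \<in> unitary_group"
proof -
  have "conj_transpose V ** conj_transpose U ** (U ** V)
      = conj_transpose V ** (conj_transpose U ** U) ** V"
    by (simp add: matrix_mul_assoc)
  moreover have "U ** V ** (conj_transpose V ** conj_transpose U)
      = U ** (V ** conj_transpose V) ** conj_transpose U"
    by (simp add: matrix_mul_assoc)
  ultimately show ?thesis
    using assms by (simp add: unitary_group_def conj_transpose_mult)
qed

lemma torus_action_unitary:
  assumes "t \<in> torus" "p \<in> unitary_group \<times> unitary_group"
  shows "torus_action t p \<in> unitary_group \<times> unitary_group"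
proof -
  have "diag_mat t \<in> unitary_group" "diag_mat (\<chi> i. cnj (t $ i)) \<in> unitary_group"
    using torus_diag[OF assms(1)] by (simp_all add: unitary_group_def conj_transpose_diag)
  then show ?thesis
    using assms(2) by (auto simp: torus_action_def intro: unitary_mult)
qed

lemma torus_action_mult:
  "torus_action s (torus_action t p) = torus_action (\<chi> i. s $ i * t $ i) p"
  by (cases p) (simp add: torus_action_def matrix_mul_assoc[symmetric] diag_mat_mult mult.commute,
      simp add: matrix_mul_assoc diag_mat_mult mult.commute)

lemma torus_action_1: "torus_action (\<chi> i. 1) p = p"
  by (cases p) (simp add: torus_action_def diag_mat_1)

lemma equiv_torus_orbit_rel: "equiv (unitary_group \<times> unitary_group) torus_orbit_rel"
proof (rule equivI)
  show "torus_orbit_rel \<subseteq> (unitary_group \<times> unitary_group) \<times> (unitary_group \<times> unitary_group)"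
    using torus_action_unitary by (fastforce simp: torus_orbit_rel_def)
  have "(\<chi> i. 1) \<in> (torus :: (complex^'n) set)"
    by (simp add: torus_def)
  then show "refl_on (unitary_group \<times> unitary_group)
      (torus_orbit_rel :: (((complex^'n^'n) \<times> (complex^'n^'n)) \<times> _) set)"
    unfolding refl_on_def torus_orbit_rel_def by (auto intro!: bexI simp: torus_action_1)
  show "sym torus_orbit_rel"
  proof (rule symI)
    fix p q :: "(complex^'n^'n) \<times> (complex^'n^'n)"
    assume "(p, q) \<in> torus_orbit_rel"
    then obtain t where t: "t \<in> torus" "q = torus_action t p"
      "p \<in> unitary_group \<times> unitary_group" by (auto simp: torus_orbit_rel_def)
    have "p = torus_action (\<chi> i. cnj (t $ i)) q"
      using t by (simp add: torus_action_mult torus_cnj torus_action_1)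
    moreover have "(\<chi> i. cnj (t $ i)) \<in> torus" using t by (simp add: torus_def)
    ultimately show "(q, p) \<in> torus_orbit_rel"
      using t torus_action_unitary by (auto simp: torus_orbit_rel_def simp del: mem_Times_iff)
  qed
  show "trans torus_orbit_rel"
  proof (rule transI)
    fix p q r :: "(complex^'n^'n) \<times> (complex^'n^'n)"
    assume "(p, q) \<in> torus_orbit_rel" "(q, r) \<in> torus_orbit_rel"
    then obtain s t where st: "t \<in> torus" "s \<in> torus" "q = torus_action t p"
      "r = torus_action s q" "p \<in> unitary_group \<times> unitary_group"
      by (auto simp: torus_orbit_rel_def)
    have "(\<chi> i. s $ i * t $ i) \<in> torus" using st by (simp add: torus_def norm_mult)
    then show "(p, r) \<in> torus_orbit_rel"
      using st by (auto simp: torus_orbit_rel_def torus_action_mult simp del: mem_Times_iff)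
  qed
qed

lemma \<phi>_torus_action:
  assumes "t \<in> torus"
  shows "(case torus_action t (U, V) of (U', V') \<Rightarrow> \<phi> (U', V', x)) = \<phi> (U, V, x)"
proof -
  have "diag_mat (\<chi> i. cnj (t $ i)) ** diag_mat (complex_vec x) ** diag_mat t
      = diag_mat (complex_vec x)"
  proof -
    have "cnj (t $ i) * complex_vec x $ i * t $ i = complex_vec x $ i" for i
      using torus_cnj(2)[OF assms, of i] by (metis mult.commute mult.left_commute mult_1)
    then have "(\<chi> i. cnj (t $ i) * complex_vec x $ i * t $ i) = complex_vec x"
      unfolding vec_eq_iff vec_lambda_beta by blast
    then show ?thesis by (simp only: diag_mat_mult vec_lambda_beta)
  qed
  then show ?thesis
    unfolding torus_action_def \<phi>_def by (simp add: matrix_mul_assoc[symmetric])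
      (metis matrix_mul_assoc)
qed

lemma \<phi>_hat_class:
  assumes "U \<in> unitary_group" "V \<in> unitary_group"
  shows "\<phi>_hat (torus_orbit_rel `` {(U, V)}, x) = \<phi> (U, V, x)"
proof -
  let ?c = "torus_orbit_rel `` {(U, V)}"
  have "(U, V) \<in> ?c"
    using assms by (intro equiv_class_self[OF equiv_torus_orbit_rel]) simp
  moreover have "(case p of (U', V') \<Rightarrow> \<phi> (U', V', x)) = \<phi> (U, V, x)" if "p \<in> ?c" for p
    using that \<phi>_torus_action by (auto simp: torus_orbit_rel_def)
  ultimately have "(\<lambda>(U, V). \<phi> (U, V, x)) ` ?c = {\<phi> (U, V, x)}"
    by (auto simp: image_iff)
  then show ?thesis by (simp add: \<phi>_hat_def)
qed

end

theory Submission
  imports Defs "HOL-Computational_Algebra.Fundamental_Theorem_Algebra"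
begin

text \<open>
  All four conditions say that \<open>a\<close> is constant on each set \<open>U D(x) V\<close> with \<open>x\<close> fixed and \<open>U\<close>, \<open>V\<close>
  running over the unitary group. For the last three this is a matter of unfolding: the value of
  the function of \<open>x\<close> is read off at \<open>U = V = 1\<close>, and \<open>\<phi>\<close> is constant on the torus orbits, so that
  \<open>a \<circ> \<phi>\<close> and \<open>a \<circ> \<phi>_hat\<close> take the same values over each \<open>x\<close>.

  The content lies in comparing the first two conditions, and rests on the fact that the regular
  points of the domain are exactly the matrices \<open>U D(x) V\<close> with \<open>x\<close> in the decreasing cube: the
  singular values of a matrix \<open>Z\<close> of the domain are less than 1, and they are positive and pairwise
  distinct when \<open>Z\<close> is regular. On the one hand, each \<open>D(x)\<close> is a regular point
  (\<open>diag_mat_decreasing_cube\<close>), which lets the first condition be applied to it. On the other hand,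
  each regular point factors as \<open>U D(x) V\<close> (\<open>singular_value_decomposition\<close>), and the second condition is then applied
  to both this factorisation and the one obtained by multiplying its outer factors by unitaries.

  The decomposition avoids the general spectral theorem. As every eigenvalue of \<open>Z Z\<^sup>*\<close> is a simple
  root of the characteristic polynomial, which splits over the complex numbers, there are \<open>n\<close>
  distinct eigenvalues. Unit eigenvectors belonging to them are automatically orthogonal, and so
  form the columns of a unitary \<open>U\<close>. With \<open>x\<close> the square roots of the eigenvalues in decreasing
  order, \<open>V = D(x)\<^sup>-\<^sup>1 U\<^sup>* Z\<close> is unitary and \<open>Z = U D(x) V\<close>.
\<close>

section \<open>The Hermitian inner product\<close>

definition hermitian_product :: "complex^'n \<Rightarrow> complex^'n \<Rightarrow> complex" where
  "hermitian_product v w = (\<Sum>i\<in>UNIV. cnj (v $ i) * w $ i)"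

lemma quadratic_form_eq_hermitian_product: "quadratic_form A v = hermitian_product v (A *v v)"
  by (simp add: quadratic_form_def hermitian_product_def)

lemma conj_transpose_conj_transpose [simp]: "conj_transpose (conj_transpose A) = A"
  by (simp add: conj_transpose_def vec_eq_iff)

lemma conj_transpose_mat_1 [simp]: "conj_transpose (mat 1) = mat 1"
  by (auto simp: conj_transpose_def mat_def vec_eq_iff)

lemma hermitian_product_adjoint:
  "hermitian_product v (A *v w) = hermitian_product (conj_transpose A *v v) w"
proof -
  have "hermitian_product v (A *v w) = (\<Sum>i\<in>UNIV. \<Sum>j\<in>UNIV. cnj (v $ i) * (A $ i $ j * w $ j))"
    by (simp add: hermitian_product_def matrix_vector_mult_def sum_distrib_left)
  also have "\<dots> = (\<Sum>j\<in>UNIV. \<Sum>i\<in>UNIV. cnj (v $ i) * (A $ i $ j * w $ j))"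
    by (rule sum.swap)
  also have "\<dots> = hermitian_product (conj_transpose A *v v) w"
    by (simp add: hermitian_product_def matrix_vector_mult_def conj_transpose_def
        sum_distrib_right sum_distrib_left mult_ac)
  finally show ?thesis .
qed

lemma hermitian_product_scale_right: "hermitian_product v (c *s w) = c * hermitian_product v w"
  by (simp add: hermitian_product_def sum_distrib_left mult_ac)

lemma hermitian_product_scale_left: "hermitian_product (c *s v) w = cnj c * hermitian_product v w"
  by (simp add: hermitian_product_def sum_distrib_left mult_ac)

lemma hermitian_product_diff_right:
  "hermitian_product v (w - w') = hermitian_product v w - hermitian_product v w'"
  by (simp add: hermitian_product_def sum_subtractf right_diff_distrib)

lemma hermitian_product_self: "hermitian_product v v = complex_of_real ((norm v)\<^sup>2)"
proof -
  have "hermitian_product v v = (\<Sum>i\<in>UNIV. complex_of_real ((norm (v $ i))\<^sup>2))"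
    by (simp add: hermitian_product_def complex_norm_square mult.commute del: of_real_power)
  also have "\<dots> = complex_of_real ((norm v)\<^sup>2)"
    by (simp add: norm_vec_def L2_set_def real_sqrt_pow2 sum_nonneg)
  finally show ?thesis .
qed

lemma matrix_columns_mult_diag: "(A ** diag_mat z) $ i $ j = A $ i $ j * z $ j"
  by (simp add: matrix_matrix_mult_def diag_mat_def if_distrib cong: if_cong)

lemma diag_mat_vector_mult: "(diag_mat z *v v) $ i = z $ i * v $ i"
  by (simp add: matrix_vector_mult_def diag_mat_def if_distrib if_distribR cong: if_cong)

section \<open>Unitary matrices\<close>

lemma unitary_conj_transpose: "U \<in> unitary_group \<Longrightarrow> conj_transpose U \<in> unitary_group"
  by (simp add: unitary_group_def)

lemma mat_1_unitary: "mat 1 \<in> unitary_group"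
  by (simp add: unitary_group_def)

lemma unitaryI: "conj_transpose U ** U = mat 1 \<Longrightarrow> U \<in> unitary_group"
  by (simp add: unitary_group_def matrix_left_right_inverse)

lemma matrix_inv_unitary:
  assumes "U \<in> unitary_group"
  shows "matrix_inv U = conj_transpose U"
proof -
  have "U ** matrix_inv U = mat 1 \<and> matrix_inv U ** U = mat 1"
    unfolding matrix_inv_def
    by (rule someI[of _ "conj_transpose U"]) (use assms in \<open>simp add: unitary_group_def\<close>)
  then have "conj_transpose U ** (U ** matrix_inv U) = conj_transpose U" by simp
  then show ?thesis
    using assms by (simp add: matrix_mul_assoc unitary_group_def)
qed

section \<open>The characteristic polynomial\<close>

lemma poly_char_polynomial: "poly (char_polynomial A) c = det (mat c - A)"
proof -
  have "poly (char_polynomial A) c =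
     (\<Sum>p | p permutes UNIV. of_int (sign p) *
        (\<Prod>i\<in>UNIV. poly ((if i = p i then [:0, 1:] else 0) - [:A $ i $ p i:]) c))"
    by (simp add: char_polynomial_def det_def poly_sum poly_prod)
  also have "\<dots> = det (mat c - A)"
    by (simp add: det_def mat_def if_distrib[where f = "\<lambda>p. poly p c"] cong: if_cong)
  finally show ?thesis .
qed

lemma char_polynomial_root_eigenvalue:
  assumes "poly (char_polynomial A) c = 0"
  shows "is_eigenvalue A c"
proof -
  have "\<not> invertible (mat c - A)"
    using assms by (simp add: poly_char_polynomial invertible_det_nz)
  then obtain v where "v \<noteq> 0" "(mat c - A) *v v = 0"
    unfolding invertible_left_inverse matrix_left_invertible_ker by blast
  moreover have "mat c *v v = c *s v"
    by (simp add: vec_eq_iff matrix_vector_mult_def mat_def if_distrib if_distribR cong: if_cong)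
  ultimately show ?thesis
    by (auto simp: is_eigenvalue_def matrix_vector_mult_diff_rdistrib)
qed

text \<open>
  In the Leibniz expansion the identity contributes a product of \<open>n\<close> monic linear factors. Any other
  permutation moves some index and thereby picks up a constant entry, so its term has lower degree
  and cannot cancel the leading one.
\<close>

lemma char_polynomial_degree:
  fixes A :: "complex^'n^'n"
  shows "char_polynomial A \<noteq> 0" "degree (char_polynomial A) = CARD('n)"
proof -
  define E where "E = (\<lambda>i j. (if i = j then [:0, 1:] else 0) - [:A $ i $ j:])"
  define d where "d = (\<lambda>p. of_int (sign p) * (\<Prod>i\<in>UNIV. E i (p i)))"
  let ?P = "{p :: 'n \<Rightarrow> 'n. p permutes UNIV}"
  have fin: "finite ?P" by (simp add: finite_permutations)
  have char: "char_polynomial A = d id + sum d (?P - {id})"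
    using sum.remove[OF fin, of id d]
    by (simp add: char_polynomial_def det_def d_def E_def permutes_id)
  have diag: "degree (d id) = CARD('n)"
    by (simp add: d_def E_def sign_id degree_prod_sum_eq)
  have off: "degree (d p) < CARD('n)" if p: "p \<in> ?P - {id}" for p
  proof -
    from p obtain k where k: "p k \<noteq> k" by (auto simp: fun_eq_iff)
    have "degree (d p) \<le> degree (\<Prod>i\<in>UNIV. E i (p i))"
      by (cases "sign p = 1") (auto simp: d_def sign_def)
    also have "\<dots> \<le> (\<Sum>i\<in>UNIV. degree (E i (p i)))"
      using degree_prod_sum_le[of UNIV "\<lambda>i. E i (p i)"] by (simp add: o_def)
    also have "\<dots> < (\<Sum>i\<in>(UNIV :: 'n set). 1)"
      by (rule sum_strict_mono_ex1) (use k in \<open>auto simp: E_def intro!: exI[of _ k]\<close>)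
    finally show ?thesis by simp
  qed
  have "degree (sum d (?P - {id})) < degree (d id)"
    unfolding diag by (rule degree_sum_less) (use off in auto)
  then show "degree (char_polynomial A) = CARD('n)"
    unfolding char by (simp add: degree_add_eq_left diag)
  then show "char_polynomial A \<noteq> 0"
    by auto
qed

text \<open>
  The characteristic polynomial splits into linear factors; if all its roots are simple, it has as
  many distinct roots as its degree.
\<close>

lemma card_eigenvalues_of_simple:
  fixes A :: "complex^'n^'n"
  assumes simple: "\<And>c. is_eigenvalue A c \<Longrightarrow> eigenvalue_multiplicity A c = 1"
  shows "card {c. is_eigenvalue A c} = CARD('n)" "finite {c. is_eigenvalue A c}"
proof -
  let ?p = "char_polynomial A" let ?R = "{c. poly ?p c = 0}"
  have R: "{c. is_eigenvalue A c} = ?R"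
  proof (intro equalityI subsetI; clarify)
    fix c assume "is_eigenvalue A c"
    then have "order c ?p \<noteq> 0"
      using simple[of c] by (simp add: eigenvalue_multiplicity_def)
    then show "poly ?p c = 0" by (metis order_0I)
  qed (rule char_polynomial_root_eigenvalue)
  have ord: "order c ?p = 1" if "c \<in> ?R" for c
    using simple[of c] that R by (auto simp: eigenvalue_multiplicity_def)
  show fin: "finite {c. is_eigenvalue A c}"
    unfolding R by (rule poly_roots_finite[OF char_polynomial_degree(1)])
  have "?p = smult (lead_coeff ?p) (\<Prod>z\<in>?R. [:-z, 1:] ^ order z ?p)"
    by (rule complex_poly_decompose[symmetric])
  also have "\<dots> = smult (lead_coeff ?p) (\<Prod>z\<in>?R. [:-z, 1:])"
    by (intro arg_cong[where f = "smult _"] prod.cong) (use ord in auto)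
  finally have "degree ?p = degree (\<Prod>z\<in>?R. [:-z, 1:])"
    using char_polynomial_degree(1)[of A] by (metis degree_smult_eq leading_coeff_0_iff)
  also have "\<dots> = card ?R"
    by (simp add: degree_prod_sum_eq)
  finally show "card {c. is_eigenvalue A c} = CARD('n)"
    by (simp add: R char_polynomial_degree)
qed

section \<open>Singular value decomposition\<close>

text \<open>
  The index type carries an abstract finite linear order, so an index is first turned into its
  position, the number of smaller indices, and that position is looked up in the decreasing list
  of the elements of \<open>S\<close>.
\<close>

lemma decreasing_enumeration:
  fixes S :: "real set"
  assumes "finite S" "card S = CARD('n::{finite,linorder})"
  obtains s :: "'n::{finite,linorder} \<Rightarrow> real" where "\<And>i. s i \<in> S" "\<And>i j. i < j \<Longrightarrow> s j < s i"
proof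
  let ?rank = "\<lambda>i::'n. card {..<i}"
  let ?s = "\<lambda>i. rev (sorted_list_of_set S) ! ?rank i"
  have rank: "?rank i < card S" for i
    unfolding assms(2) by (intro psubset_card_mono) auto
  show "?s i \<in> S" for i
    using rank[of i] nth_mem[of "?rank i" "rev (sorted_list_of_set S)"] assms(1) by simp
  show "?s j < ?s i" if "i < j" for i j
  proof -
    have "?rank i < ?rank j"
      using that by (intro psubset_card_mono) auto
    moreover have "sorted_wrt (>) (rev (sorted_list_of_set S))"
      by (simp add: sorted_wrt_rev)
    ultimately show ?thesis
      using rank[of j] assms(1) by (auto dest: sorted_wrt_nth_less)
  qed
qed

text \<open>The quadratic form at an eigenvector \<open>v\<close> equals \<open>c \<parallel>v\<parallel>\<^sup>2\<close>.\<close>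

lemma pos_definite_eigenvalue_real:
  assumes "pos_definite A" "A *v v = c *s v" "v \<noteq> 0"
  shows "c \<in> \<real>" "0 < Re c"
proof -
  have q: "quadratic_form A v = c * complex_of_real ((norm v)\<^sup>2)"
    by (simp add: quadratic_form_eq_hermitian_product assms(2) hermitian_product_scale_right
        hermitian_product_self)
  have n: "(norm v)\<^sup>2 > 0" using assms(3) by simp
  have "Im (quadratic_form A v) = 0" "0 < Re (quadratic_form A v)"
    using assms(1,3) by (auto simp: pos_definite_def complex_is_Real_iff)
  then show "c \<in> \<real>" "0 < Re c"
    using n by (simp_all add: q complex_is_Real_iff zero_less_mult_iff)
qed

lemma hermitian_eigenvectors_orthogonal:
  assumes "conj_transpose A = A" "A *v v = complex_of_real c *s v" "A *v w = complex_of_real d *s w"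
    and "c \<noteq> d"
  shows "hermitian_product v w = 0"
proof -
  have "complex_of_real d * hermitian_product v w = complex_of_real c * hermitian_product v w"
    using hermitian_product_adjoint[of v A w] assms(1-3)
    by (simp add: hermitian_product_scale_left hermitian_product_scale_right)
  then show ?thesis using assms(4) by simp
qed

text \<open>
  The domain is described by \<open>Z\<^sup>* Z\<close>, regularity by \<open>Z Z\<^sup>*\<close>. The two share their nonzero eigenvalues:
  if \<open>v\<close> is an eigenvector of \<open>Z Z\<^sup>*\<close>, then \<open>w = Z\<^sup>* v\<close> is one of \<open>Z\<^sup>* Z\<close> for the same \<open>c\<close>, and the
  quadratic form of \<open>1 - Z\<^sup>* Z\<close> at \<open>w\<close> is \<open>(1 - c) \<parallel>w\<parallel>\<^sup>2\<close>.
\<close>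

lemma cartan_domain_singular_value_less_1:
  assumes Z: "Z \<in> cartan_domain_I"
    and eig: "(Z ** conj_transpose Z) *v v = complex_of_real c *s v" "v \<noteq> 0" and "c \<noteq> 0"
  shows "c < 1"
proof -
  let ?w = "conj_transpose Z *v v"
  have Zw: "Z *v ?w = complex_of_real c *s v"
    using eig(1) by (simp add: matrix_vector_mul_assoc)
  then have w: "?w \<noteq> 0"
    using eig(2) \<open>c \<noteq> 0\<close> by auto
  have "conj_transpose Z *v (Z *v ?w) = complex_of_real c *s ?w"
    unfolding Zw by (simp add: vector_scalar_commute)
  then have "quadratic_form (mat 1 - conj_transpose Z ** Z) ?w
      = complex_of_real (1 - c) * complex_of_real ((norm ?w)\<^sup>2)"
    by (simp add: quadratic_form_eq_hermitian_product matrix_vector_mult_diff_rdistrib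
        matrix_vector_mul_assoc[symmetric] hermitian_product_diff_right
        hermitian_product_scale_right hermitian_product_self algebra_simps)
  moreover have "0 < Re (quadratic_form (mat 1 - conj_transpose Z ** Z) ?w)"
    using Z w by (auto simp: cartan_domain_I_def matrix_less_def pos_definite_def)
  ultimately have "0 < (1 - c) * (norm ?w)\<^sup>2"
    by (metis Re_complex_of_real of_real_mult)
  then show ?thesis
    by (simp add: zero_less_mult_iff)
qed

text \<open>
  Eigenvectors of a Hermitian matrix for distinct eigenvalues are orthogonal. There are enough
  eigenvalues here to fill all columns with unit eigenvectors, and orthonormal columns make \<open>U\<close>
  unitary.
\<close>

lemma hermitian_diagonalisation:
  fixes A :: "complex^'n^'n" and s :: "'n \<Rightarrow> real"
  assumes "conj_transpose A = A" "inj s" "\<And>i. is_eigenvalue A (complex_of_real (s i))"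
  obtains U where "U \<in> unitary_group" "A ** U = U ** diag_mat (\<chi> i. complex_of_real (s i))"
proof -
  have "\<exists>u. norm u = 1 \<and> A *v u = complex_of_real (s i) *s u" for i
  proof -
    obtain v where v: "v \<noteq> 0" "A *v v = complex_of_real (s i) *s v"
      using assms(3) by (auto simp: is_eigenvalue_def)
    let ?u = "complex_of_real (1 / norm v) *s v"
    have "complex_of_real ((norm ?u)\<^sup>2) = complex_of_real (1 / norm v * (1 / norm v) * (norm v)\<^sup>2)"
      unfolding hermitian_product_self[symmetric] hermitian_product_scale_left
          hermitian_product_scale_right of_real_mult by simp
    then have "(norm ?u)\<^sup>2 = 1\<^sup>2"
      using v(1) unfolding of_real_eq_iff by (simp add: power2_eq_square)
    then have "norm ?u = 1"
      by (rule power2_eq_imp_eq) simp_all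
    moreover have "A *v ?u = complex_of_real (s i) *s ?u"
      using v(2) by (simp add: vector_scalar_commute mult.commute)
    ultimately show ?thesis by blast
  qed
  then obtain u where u: "\<And>i. norm (u i) = 1" "\<And>i. A *v u i = complex_of_real (s i) *s u i"
    by metis
  define U where "U = (\<chi> i j. u j $ i)"
  have "(conj_transpose U ** U) $ i $ j = hermitian_product (u i) (u j)" for i j
    by (simp add: U_def matrix_matrix_mult_def conj_transpose_def hermitian_product_def)
  moreover have "hermitian_product (u i) (u j) = (if i = j then 1 else 0)" for i j
    using hermitian_eigenvectors_orthogonal[OF assms(1) u(2) u(2), of i j] assms(2) u(1)
    by (auto simp: hermitian_product_self inj_eq)
  ultimately have "U \<in> unitary_group"
    by (intro unitaryI) (simp add: vec_eq_iff mat_def)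
  moreover have "(A ** U) $ i $ j = (U ** diag_mat (\<chi> i. complex_of_real (s i))) $ i $ j" for i j
  proof -
    have "(A ** U) $ i $ j = (A *v u j) $ i"
      by (simp add: U_def matrix_matrix_mult_def matrix_vector_mult_def)
    then show ?thesis
      by (simp add: u(2) matrix_columns_mult_diag U_def mult.commute)
  qed
  ultimately show ?thesis
    using that by (simp add: vec_eq_iff)
qed

text \<open>
  Once \<open>Z Z\<^sup>* U = U D(s)\<close> with \<open>U\<close> unitary and \<open>x\<^sub>i = \<surd>s\<^sub>i\<close>, the identity \<open>Z = U D(x) V\<close> leaves no choice for
  \<open>V\<close>, and \<open>V V\<^sup>* = D(x)\<^sup>-\<^sup>1 U\<^sup>* Z Z\<^sup>* U D(x)\<^sup>-\<^sup>1 = D(x)\<^sup>-\<^sup>1 D(s) D(x)\<^sup>-\<^sup>1 = 1\<close>.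
\<close>

theorem singular_value_decomposition:
  fixes Z :: "complex^'n::{finite,linorder}^'n::{finite,linorder}"
  assumes "Z \<in> cartan_domain_I" "Z \<in> regular_matrices"
  obtains U V x where "U \<in> unitary_group" "V \<in> unitary_group" "x \<in> decreasing_cube"
    "Z = U ** diag_mat (complex_vec x) ** V"
proof -
  let ?A = "Z ** conj_transpose Z"
  let ?E = "{c. is_eigenvalue ?A c}"
  have pd: "pos_definite ?A" and simple: "\<And>c. is_eigenvalue ?A c \<Longrightarrow> eigenvalue_multiplicity ?A c = 1"
    using assms(2) by (auto simp: regular_matrices_def)
  have E: "complex_of_real (Re c) = c \<and> 0 < Re c \<and> Re c < 1" if "is_eigenvalue ?A c" for c
  proof -
    from that obtain v where v: "v \<noteq> 0" "?A *v v = c *s v" by (auto simp: is_eigenvalue_def)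
    note pos = pos_definite_eigenvalue_real[OF pd v(2,1)]
    then have "complex_of_real (Re c) = c" by simp
    with v pos show ?thesis
      using cartan_domain_singular_value_less_1[OF assms(1), of v "Re c"] by auto
  qed
  \<comment> \<open>The eigenvalues are real, so passing to real parts loses none of them.\<close>
  have "inj_on Re ?E"
    using E by (intro inj_onI) (metis mem_Collect_eq)
  then have "card (Re ` ?E) = CARD('n)" "finite (Re ` ?E)"
    using card_eigenvalues_of_simple[OF simple] by (simp_all add: card_image)
  then obtain s :: "'n \<Rightarrow> real" where
    s: "\<And>i. s i \<in> Re ` ?E" "\<And>i j. i < j \<Longrightarrow> s j < s i"
    using decreasing_enumeration by blast
  have eig: "is_eigenvalue ?A (complex_of_real (s i))" and pos: "0 < s i" and less: "s i < 1" for i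
    using s(1)[of i] E by auto
  have "inj s"
    using s(2) by (metis injI less_irrefl linorder_neqE)
  then obtain U where U: "U \<in> unitary_group"
    and AU: "?A ** U = U ** diag_mat (\<chi> i. complex_of_real (s i))"
    using hermitian_diagonalisation[of ?A s] pd eig unfolding pos_definite_def by blast
  define x :: "real^'n::{finite,linorder}" where "x = (\<chi> i. sqrt (s i))"
  define y where "y = complex_vec (\<chi> i. 1 / sqrt (s i))"
  define V where "V = diag_mat y ** conj_transpose U ** Z"
  have x: "x \<in> decreasing_cube"
    using s(2) pos less by (simp add: decreasing_cube_def x_def)
  have xy: "diag_mat (complex_vec x) ** diag_mat y = mat 1"
  proof -
    have "(\<chi> i. complex_vec x $ i * y $ i) = (\<chi> i. 1)"
      using pos by (simp add: complex_vec_def x_def y_def vec_eq_iff less_imp_neq[symmetric])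
    then show ?thesis by (simp add: diag_mat_mult diag_mat_1)
  qed
  have "conj_transpose V = conj_transpose Z ** U ** diag_mat y"
    by (simp add: V_def conj_transpose_mult conj_transpose_diag matrix_mul_assoc)
      (simp add: y_def complex_vec_def)
  then have "V ** conj_transpose V
      = diag_mat y ** conj_transpose U ** (?A ** U) ** diag_mat y"
    by (simp add: V_def matrix_mul_assoc)
  also have "\<dots> = diag_mat y ** (conj_transpose U ** U) ** diag_mat (\<chi> i. complex_of_real (s i))
      ** diag_mat y"
    by (simp add: AU matrix_mul_assoc)
  also have "\<dots> = diag_mat (\<chi> i. y $ i * complex_of_real (s i) * y $ i)"
    using U by (simp add: unitary_group_def diag_mat_mult)
  also have "(\<chi> i. y $ i * complex_of_real (s i) * y $ i) = (\<chi> i. 1)"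
  proof -
    have "y $ i * complex_of_real (s i) * y $ i = 1" for i
    proof -
      have "1 / sqrt (s i) * s i * (1 / sqrt (s i)) = 1"
        using pos[of i] by (simp add: field_simps)
      then show ?thesis
        unfolding y_def complex_vec_def vec_lambda_beta by (metis of_real_1 of_real_mult)
    qed
    then show ?thesis by simp
  qed
  finally have "V ** conj_transpose V = mat 1"
    by (simp add: diag_mat_1)
  then have V: "V \<in> unitary_group"
    by (simp add: unitary_group_def matrix_left_right_inverse)
  have "U ** diag_mat (complex_vec x) ** V
      = U ** (diag_mat (complex_vec x) ** diag_mat y) ** conj_transpose U ** Z"
    by (simp add: V_def matrix_mul_assoc)
  also have "\<dots> = Z"
    using U by (simp add: xy unitary_group_def)
  finally show ?thesis
    using that[OF U V x] by simp
qed

section \<open>Diagonal matrices over the cube are regular points of the domain\<close>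

lemma pos_definite_diag:
  assumes "\<And>i. 0 < x $ i"
  shows "pos_definite (diag_mat (complex_vec x))"
  unfolding pos_definite_def
proof (intro conjI allI impI)
  show "conj_transpose (diag_mat (complex_vec x)) = diag_mat (complex_vec x)"
    by (simp add: conj_transpose_diag complex_vec_def)
  fix v :: "complex^'a" assume "v \<noteq> 0"
  then obtain k where k: "v $ k \<noteq> 0" by (auto simp: vec_eq_iff)
  have q: "quadratic_form (diag_mat (complex_vec x)) v
      = complex_of_real (\<Sum>i\<in>UNIV. x $ i * (norm (v $ i))\<^sup>2)"
    unfolding quadratic_form_def diag_mat_vector_mult of_real_sum
    by (intro sum.cong refl) (simp add: complex_vec_def complex_norm_square mult_ac del: of_real_power)
  then show "quadratic_form (diag_mat (complex_vec x)) v \<in> \<real>" by simp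
  have "0 < (\<Sum>i\<in>UNIV. x $ i * (norm (v $ i))\<^sup>2)"
    by (rule sum_pos2[of _ k]) (use assms k in \<open>auto simp: less_imp_le\<close>)
  then show "0 < Re (quadratic_form (diag_mat (complex_vec x)) v)" by (simp add: q)
qed

text \<open>
  The characteristic polynomial is the product of the linear factors at the diagonal entries, and
  distinctness of the entries means that an eigenvalue is a root of only one of them.
\<close>

lemma diag_eigenvalue_simple:
  assumes inj: "\<And>i j. z $ i = z $ j \<Longrightarrow> i = j" and "is_eigenvalue (diag_mat z) c"
  shows "eigenvalue_multiplicity (diag_mat z) c = 1"
proof -
  obtain v where v: "v \<noteq> 0" "diag_mat z *v v = c *s v"
    using assms(2) by (auto simp: is_eigenvalue_def)
  then obtain k where k: "v $ k \<noteq> 0" by (auto simp: vec_eq_iff)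
  have "z $ k * v $ k = c * v $ k"
    using v(2) diag_mat_vector_mult[of z v k] by (metis vector_smult_component)
  then have c: "c = z $ k" using k mult_right_cancel by metis
  let ?q = "\<Prod>i\<in>UNIV - {k}. [:- (z $ i), 1:]"
  have "char_polynomial (diag_mat z) = (\<Prod>i\<in>UNIV. [:- (z $ i), 1:])"
    unfolding char_polynomial_def by (subst det_diagonal) (simp_all add: diag_mat_def)
  also have "\<dots> = [:- c, 1:] * ?q"
    by (simp add: c prod.remove[of UNIV k])
  finally have char: "char_polynomial (diag_mat z) = [:- c, 1:] * ?q" .
  have q: "poly ?q c \<noteq> 0"
    using inj by (auto simp: poly_prod c)
  have "order c [:- c, 1:] = 1"
    using order_power_n_n[of c 1] by simp
  moreover have "[:- c, 1:] * ?q \<noteq> 0"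
    using q by (metis mult_eq_0_iff pCons_eq_0_iff one_neq_zero poly_0)
  ultimately show ?thesis
    by (simp add: eigenvalue_multiplicity_def char order_mult order_0I[OF q] del: mult_pCons_left)
qed

lemma diag_mat_decreasing_cube:
  assumes x: "x \<in> decreasing_cube"
  shows "diag_mat (complex_vec x) \<in> cartan_domain_I \<inter> regular_matrices"
proof -
  let ?D = "diag_mat (complex_vec x)"
  have pos: "0 < x $ i" "x $ i < 1" for i using x by (auto simp: decreasing_cube_def)
  have inj: "i = j" if "x $ i = x $ j" for i j
    using x that by (metis (mono_tags, lifting) decreasing_cube_def less_irrefl linorder_neqE
        mem_Collect_eq)
  have DD: "?D ** conj_transpose ?D = diag_mat (complex_vec (\<chi> i. (x $ i)\<^sup>2))"
    "conj_transpose ?D ** ?D = diag_mat (complex_vec (\<chi> i. (x $ i)\<^sup>2))"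
    by (simp_all add: conj_transpose_diag diag_mat_mult complex_vec_def power2_eq_square)
  have "mat 1 - conj_transpose ?D ** ?D = diag_mat (complex_vec (\<chi> i. 1 - (x $ i)\<^sup>2))"
    unfolding DD by (simp add: vec_eq_iff diag_mat_def mat_def complex_vec_def)
  moreover have "(x $ i)\<^sup>2 < 1" for i
    using pos[of i] by (simp add: power_less_one_iff)
  ultimately have "?D \<in> cartan_domain_I"
    by (simp add: cartan_domain_I_def matrix_less_def pos_definite_diag)
  moreover have "pos_definite (?D ** conj_transpose ?D)"
    unfolding DD using pos by (intro pos_definite_diag) (simp add: less_imp_neq[symmetric])
  moreover have "eigenvalue_multiplicity (?D ** conj_transpose ?D) c = 1"
    if "is_eigenvalue (?D ** conj_transpose ?D) c" for c
    using that unfolding DD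
  proof (rule diag_eigenvalue_simple[rotated])
    fix i j assume "complex_vec (\<chi> i. (x $ i)\<^sup>2) $ i = complex_vec (\<chi> i. (x $ i)\<^sup>2) $ j"
    then have "(x $ i)\<^sup>2 = (x $ j)\<^sup>2"
      unfolding complex_vec_def vec_lambda_beta by (rule of_real_eq_iff[THEN iffD1])
    then have "x $ i = x $ j"
      using pos[of i] pos[of j] by (simp add: power2_eq_iff_nonneg less_imp_le)
    then show "i = j" by (rule inj)
  qed
  ultimately show ?thesis
    by (simp add: regular_matrices_def)
qed

section \<open>Equivalence of the invariance conditions\<close>

theorem proposition3p5:
  fixes a :: "complex^'n::{finite,linorder}^'n::{finite,linorder} \<Rightarrow> complex"
  assumes "a \<in> Linfty (lebesgue_on cartan_domain_I)"
  shows
    "let cond1 = (\<forall>U\<in>unitary_group. \<forall>V\<in>unitary_group. \<forall>Z\<in>cartan_domain_I \<inter> regular_matrices.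
           a (matrix_inv U ** Z ** V) = a Z);
         cond2 = (\<forall>U\<in>unitary_group. \<forall>V\<in>unitary_group. \<forall>x\<in>decreasing_cube.
           a (U ** diag_mat (complex_vec x) ** V) = a (diag_mat (complex_vec x)));
         cond3 = depends_only_on (\<lambda>(U, V, x). x)
           (unitary_group \<times> unitary_group \<times> decreasing_cube) (a \<circ> \<phi>);
         cond4 = depends_only_on (\<lambda>(c, x). x)
           (torus_quotient \<times> decreasing_cube) (a \<circ> \<phi>_hat)
     in (cond1 \<longleftrightarrow> cond2) \<and> (cond2 \<longleftrightarrow> cond3) \<and> (cond3 \<longleftrightarrow> cond4)"
proof (unfold Let_def, intro conjI)
  show "(\<forall>U\<in>unitary_group. \<forall>V\<in>unitary_group. \<forall>Z\<in>cartan_domain_I \<inter> regular_matrices.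
           a (matrix_inv U ** Z ** V) = a Z)
     \<longleftrightarrow> (\<forall>U\<in>unitary_group. \<forall>V\<in>unitary_group. \<forall>x\<in>decreasing_cube.
           a (U ** diag_mat (complex_vec x) ** V) = a (diag_mat (complex_vec x)))"
    (is "?C1 \<longleftrightarrow> ?C2")
  proof
    assume C1: ?C1
    show ?C2
    proof (intro ballI)
      fix U V :: "complex^'n::{finite,linorder}^'n::{finite,linorder}" and x :: "real^'n::{finite,linorder}"
      assume U: "U \<in> unitary_group" and V: "V \<in> unitary_group" and x: "x \<in> decreasing_cube"
      \<comment> \<open>The first condition multiplies by an inverse on the left, so it is applied to \<open>U\<^sup>*\<close>.\<close>
      have "matrix_inv (conj_transpose U) = U"
        using matrix_inv_unitary[OF unitary_conj_transpose[OF U]] by simp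
      then show "a (U ** diag_mat (complex_vec x) ** V) = a (diag_mat (complex_vec x))"
        using C1 unitary_conj_transpose[OF U] V diag_mat_decreasing_cube[OF x] by metis
    qed
  next
    assume C2: ?C2
    show ?C1
    proof (intro ballI)
      fix U V Z :: "complex^'n::{finite,linorder}^'n::{finite,linorder}"
      assume U: "U \<in> unitary_group" and V: "V \<in> unitary_group"
        and Z: "Z \<in> cartan_domain_I \<inter> regular_matrices"
      then obtain P Q x where PQ: "P \<in> unitary_group" "Q \<in> unitary_group" "x \<in> decreasing_cube"
        "Z = P ** diag_mat (complex_vec x) ** Q"
        using singular_value_decomposition by blast
      have "matrix_inv U ** Z ** V
          = (conj_transpose U ** P) ** diag_mat (complex_vec x) ** (Q ** V)"
        by (simp add: matrix_inv_unitary[OF U] PQ(4) matrix_mul_assoc)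
      then show "a (matrix_inv U ** Z ** V) = a Z"
        using C2 PQ unitary_mult[OF unitary_conj_transpose[OF U] PQ(1)] unitary_mult[OF PQ(2) V]
        by metis
    qed
  qed
  show "(\<forall>U\<in>unitary_group. \<forall>V\<in>unitary_group. \<forall>x\<in>decreasing_cube.
           a (U ** diag_mat (complex_vec x) ** V) = a (diag_mat (complex_vec x)))
     \<longleftrightarrow> depends_only_on (\<lambda>(U, V, x). x)
           (unitary_group \<times> unitary_group \<times> decreasing_cube) (a \<circ> \<phi>)"
    (is "?C2 \<longleftrightarrow> ?C3")
  proof
    assume ?C2
    then show ?C3
      unfolding depends_only_on_def
      by (intro exI[of _ "\<lambda>x. a (diag_mat (complex_vec x))"]) (auto simp: \<phi>_def)
  next
    assume ?C3
    then obtain g where g: "a (U ** diag_mat (complex_vec x) ** V) = g x"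
      if "U \<in> unitary_group" "V \<in> unitary_group" "x \<in> decreasing_cube" for U V x
      unfolding depends_only_on_def by (fastforce simp: \<phi>_def)
    show ?C2
      using g g[OF mat_1_unitary mat_1_unitary] by simp
  qed
  show "depends_only_on (\<lambda>(U, V, x). x)
           (unitary_group \<times> unitary_group \<times> decreasing_cube) (a \<circ> \<phi>)
     \<longleftrightarrow> depends_only_on (\<lambda>(c, x). x) (torus_quotient \<times> decreasing_cube) (a \<circ> \<phi>_hat)"
  proof -
    \<comment> \<open>The same function \<open>g\<close> of \<open>x\<close> works for both.\<close>
    have "(\<forall>y\<in>unitary_group \<times> unitary_group \<times> decreasing_cube.
            (a \<circ> \<phi>) y = g (case y of (U, V, x) \<Rightarrow> x))
      \<longleftrightarrow> (\<forall>y\<in>torus_quotient \<times> decreasing_cube. (a \<circ> \<phi>_hat) y = g (case y of (c, x) \<Rightarrow> x))" for g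
      by (auto simp: torus_quotient_def quotient_def \<phi>_hat_class)
    then show ?thesis
      unfolding depends_only_on_def by simp
  qed
qed

end
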